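(* There is an absolute constant $C$ such that for every positive integer $r$ and every $m$ for which a $\mathrm{DD}^*(m,r)$ exists, \[ m\leq \tfrac{\sqrt{\pi}}{\sqrt{2}\,3^{1/4}}\,r+\tfrac{3^{5/6}\pi^{1/3}}{2^{4/3}}\,r^{2/3}+C\,r^{1/3}. \]
   Context: The hexagonal grid is the set of centres of a tiling of the plane by regular hexagons in which centres of hexagons sharing an edge are at Euclidean distance $1$; concretely it is the lattice $\{i(1,0)+j(-\tfrac12,\tfrac{\sqrt3}{2}) : i,j\in\mathbb{Z}\}\subset\mathbb{R}^2$. A $\mathrm{DD}^*(m,r)$ (Euclidean hexagonal distinct difference configuration) is a set of $m$ points ("dots") of the hexagonal grid such that (1) any two dots are at Euclidean distance at most $r$, and (2) the lines joining pairs of dots are pairwise distinct either in length or in slope; equivalently, the vectors $a-b$, over ordered pairs $(a,b)$ of distinct dots, are pairwise distinct. *)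

theory Defs
  imports "HOL-Analysis.Analysis"
begin

definition hex_grid :: "(real^2) set" where
  "hex_grid = {of_int i *\<^sub>R vector [1, 0] + of_int j *\<^sub>R vector [- 1/2, sqrt 3 / 2] | i j :: int. True}"

(* None is the slope of vertical lines. *)
definition slope :: "real^2 \<Rightarrow> real^2 \<Rightarrow> real option" where
  "slope a b = (if a $ 1 = b $ 1 then None else Some ((a $ 2 - b $ 2) / (a $ 1 - b $ 1)))"

definition DD_star :: "nat \<Rightarrow> real \<Rightarrow> (real^2) set \<Rightarrow> bool" where
  "DD_star m r D \<longleftrightarrow>
     D \<subseteq> hex_grid \<and> finite D \<and> card D = m \<and>
     (\<forall>a\<in>D. \<forall>b\<in>D. dist a b \<le> r) \<and>
     (\<forall>a\<in>D. \<forall>b\<in>D. \<forall>c\<in>D. \<forall>d\<in>D. a \<noteq> b \<longrightarrow> c \<noteq> d \<longrightarrow> {a, b} \<noteq> {c, d} \<longrightarrow>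
        dist a b \<noteq> dist c d \<or> slope a b \<noteq> slope c d)"

lemma dist_slope_eq_iff:
  fixes a b c d :: "real^2"
  assumes "a \<noteq> b" "c \<noteq> d"
  shows "dist a b = dist c d \<and> slope a b = slope c d \<longleftrightarrow> a - b = c - d \<or> a - b = d - c"
proof -
  define x y u v where "x = a $ 1 - b $ 1" and "y = a $ 2 - b $ 2"
    and "u = c $ 1 - d $ 1" and "v = c $ 2 - d $ 2"
  note defs = x_def y_def u_def v_def
  have d: "dist a b = dist c d \<longleftrightarrow> x\<^sup>2 + y\<^sup>2 = u\<^sup>2 + v\<^sup>2"
    by (simp add: dist_norm norm_eq_sqrt_inner inner_vec_def sum_2 defs power2_eq_square)
  have s: "slope a b = slope c d \<longleftrightarrow> (x = 0 \<and> u = 0) \<or> (x \<noteq> 0 \<and> u \<noteq> 0 \<and> y / x = v / u)"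
    by (auto simp: slope_def defs)
  have e: "a - b = c - d \<longleftrightarrow> x = u \<and> y = v" "a - b = d - c \<longleftrightarrow> x = - u \<and> y = - v"
    by (auto simp: vec_eq_iff forall_2 defs)
  have nz: "x \<noteq> 0 \<or> y \<noteq> 0" "u \<noteq> 0 \<or> v \<noteq> 0"
    using assms by (auto simp: vec_eq_iff forall_2 defs)
  have "(x = u \<and> y = v) \<or> (x = - u \<and> y = - v)"
    if 1: "x\<^sup>2 + y\<^sup>2 = u\<^sup>2 + v\<^sup>2" and 2: "x \<noteq> 0" "u \<noteq> 0" "y / x = v / u"
  proof -
    define k where "k = y / x"
    have y: "y = k * x" using 2(1) by (simp add: k_def)
    have v: "v = k * u" unfolding k_def 2(3) using 2(2) by simp
    have "(1 + k\<^sup>2) * x\<^sup>2 = (1 + k\<^sup>2) * u\<^sup>2" using 1 by (simp add: y v algebra_simps power_mult_distrib)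
    moreover have "1 + k\<^sup>2 \<noteq> 0" by (smt (verit) zero_le_power2)
    ultimately have "x\<^sup>2 = u\<^sup>2" by simp
    then show ?thesis by (auto simp: y v power2_eq_iff)
  qed
  moreover have "(x = u \<and> y = v) \<or> (x = - u \<and> y = - v)"
    if "x\<^sup>2 + y\<^sup>2 = u\<^sup>2 + v\<^sup>2" "x = 0" "u = 0"
    using that by (auto simp: power2_eq_iff)
  ultimately show ?thesis
    unfolding d s e by auto
qed

lemma DD_star_iff_differences:
  "DD_star m r D \<longleftrightarrow>
     D \<subseteq> hex_grid \<and> finite D \<and> card D = m \<and>
     (\<forall>a\<in>D. \<forall>b\<in>D. dist a b \<le> r) \<and>
     inj_on (\<lambda>(a, b). a - b) {(a, b). a \<in> D \<and> b \<in> D \<and> a \<noteq> b}"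
proof -
  have "(\<forall>a\<in>D. \<forall>b\<in>D. \<forall>c\<in>D. \<forall>d\<in>D. a \<noteq> b \<longrightarrow> c \<noteq> d \<longrightarrow> {a, b} \<noteq> {c, d} \<longrightarrow>
          dist a b \<noteq> dist c d \<or> slope a b \<noteq> slope c d) \<longleftrightarrow>
        inj_on (\<lambda>(a, b). a - b) {(a, b). a \<in> D \<and> b \<in> D \<and> a \<noteq> b}" (is "?L \<longleftrightarrow> ?R")
  proof
    assume L: ?L
    have "a = c \<and> b = d"
      if "a \<in> D" "b \<in> D" "c \<in> D" "d \<in> D" "a \<noteq> b" "c \<noteq> d" and eq: "a - b = c - d" for a b c d
    proof -
      have "{a, b} = {c, d}"
        using L that dist_slope_eq_iff[of a b c d] by blast
      moreover have "\<not> (a = d \<and> b = c)"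
      proof
        assume h: "a = d \<and> b = c"
        then have "2 *\<^sub>R (c - d) = 0" using eq by (simp add: algebra_simps scaleR_2)
        then show False using \<open>c \<noteq> d\<close> by simp
      qed
      ultimately show ?thesis by (auto simp: doubleton_eq_iff)
    qed
    then show ?R by (auto simp: inj_on_def)
  next
    assume R: ?R
    have inj: "a = c \<and> b = d"
      if "a \<in> D" "b \<in> D" "c \<in> D" "d \<in> D" "a \<noteq> b" "c \<noteq> d" "a - b = c - d" for a b c d
      using inj_onD[OF R, of "(a, b)" "(c, d)"] that by auto
    show ?L
    proof (intro ballI impI)
      fix a b c d
      assume h: "a \<in> D" "b \<in> D" "c \<in> D" "d \<in> D" "a \<noteq> b" "c \<noteq> d" "{a, b} \<noteq> {c, d}"
      have "a - b \<noteq> c - d" using inj[of a b c d] h by auto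
      moreover have "a - b \<noteq> d - c" using inj[of a b d c] h by auto
      ultimately show "dist a b \<noteq> dist c d \<or> slope a b \<noteq> slope c d"
        using dist_slope_eq_iff[of a b c d] h by blast
    qed
  qed
  then show ?thesis unfolding DD_star_def by simp
qed

end

theory Submission
  imports Defs
begin

text \<open>
  Slide a disc of radius \<open>s\<close> over a planar lattice of covolume \<open>V\<close> and count the dots it contains. If
  the disc has \<open>a\<close> lattice points and \<open>N\<close> of its positions meet the \<open>m\<close> dots, the counts sum to \<open>a m\<close>;
  since a difference vector occurs at most once, their squares sum to at most \<open>a\<^sup>2 + a m\<close>.
  Cauchy--Schwarz gives \<open>a m\<^sup>2 \<le> N (a + m)\<close>. The \<open>N\<close> positions form a set of diameter at most
  \<open>r + 2 s\<close>, so the isodiametric inequality bounds \<open>\<surd>N\<close> by \<open>\<kappa> (r / 2 + s)\<close> up to a constant, where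
  \<open>\<kappa>\<^sup>2 = \<pi> / V\<close>, while \<open>a\<close> is \<open>\<kappa>\<^sup>2 s\<^sup>2 + O(s)\<close>. Hence \<open>m\<close> is at most
  \<open>\<kappa> r / 2 + \<kappa> s + r\<^sup>2 / (8 s\<^sup>2)\<close> up to lower order terms, which is minimal for
  \<open>s = (r\<^sup>2 / (4 \<kappa>))\<^sup>1\<^sup>/\<^sup>3\<close>. For the hexagonal grid \<open>V = \<surd>3 / 2\<close>.
\<close>

section \<open>Sets with distinct differences\<close>

definition distinct_differences :: "'a::ab_group_add set \<Rightarrow> bool" where
  "distinct_differences D \<longleftrightarrow> inj_on (\<lambda>(a, b). a - b) (D \<times> D - Id)"

definition difference_set :: "'a::ab_group_add set \<Rightarrow> 'a set \<Rightarrow> 'a set" where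
  "difference_set D S = {d - s | d s. d \<in> D \<and> s \<in> S}"

definition in_translate :: "'a::ab_group_add set \<Rightarrow> 'a set \<Rightarrow> 'a \<Rightarrow> 'a set" where
  "in_translate D S x = {d \<in> D. d - x \<in> S}"

lemma finite_difference_set: "finite D \<Longrightarrow> finite S \<Longrightarrow> finite (difference_set D S)"
  unfolding difference_set_def by (rule finite_image_set2) simp_all

lemma finite_in_translate: "finite D \<Longrightarrow> finite (in_translate D S x)"
  by (simp add: in_translate_def)

lemma sum_card_in_translate:
  assumes "finite D" "finite S"
  shows "(\<Sum>x\<in>difference_set D S. card (in_translate D S x)) = card D * card S"
proof -
  have "bij_betw (\<lambda>(x, d). (d, d - x)) (SIGMA x:difference_set D S. in_translate D S x) (D \<times> S)"
    by (rule bij_betw_byWitness[where f' = "\<lambda>(d, s). (d - s, d)"])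
       (auto simp: difference_set_def in_translate_def)
  then have "card (SIGMA x:difference_set D S. in_translate D S x) = card D * card S"
    by (simp add: bij_betw_same_card card_cartesian_product)
  then show ?thesis
    using assms by (simp add: finite_difference_set finite_in_translate)
qed

text \<open>A pair of distinct elements of \<open>S\<close> determines the difference of the two elements of \<open>D\<close> that
  occupy it, hence these elements and the translation.\<close>

lemma sum_card_in_translate_pairs_le:
  assumes "finite X" "finite D" "finite S" "distinct_differences D"
  shows "(\<Sum>x\<in>X. card (in_translate D S x \<times> in_translate D S x - Id)) \<le> (card S)\<^sup>2"
proof -
  define P where "P = (SIGMA x:X. in_translate D S x \<times> in_translate D S x - Id)"
  have unique: "(x, d, d') = (y, e, e')"
    if P: "(x, d, d') \<in> P" "(y, e, e') \<in> P" and eq: "d - x = e - y" "d' - x = e' - y"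
    for x d d' y e e'
  proof -
    have "d - d' = (d - x) - (d' - x)" by simp
    also have "\<dots> = e - e'" by (simp add: eq)
    finally have "(d, d') = (e, e')"
      using P by (intro inj_onD[OF assms(4)[unfolded distinct_differences_def]])
        (auto simp: P_def in_translate_def)
    with eq(1) show ?thesis by simp
  qed
  have "card P \<le> card (S \<times> S)"
  proof (rule card_inj_on_le)
    show "inj_on (\<lambda>(x, d, d'). (d - x, d' - x)) P"
      using unique by (force intro!: inj_onI)
    show "(\<lambda>(x, d, d'). (d - x, d' - x)) ` P \<subseteq> S \<times> S"
      by (auto simp: P_def in_translate_def)
  qed (use \<open>finite S\<close> in simp)
  moreover have "card P = (\<Sum>x\<in>X. card (in_translate D S x \<times> in_translate D S x - Id))"
    using assms by (simp add: P_def finite_in_translate)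
  ultimately show ?thesis
    by (simp add: card_cartesian_product power2_eq_square)
qed

lemma square_card_eq_card_add_off_diagonal:
  assumes "finite T"
  shows "(card T)\<^sup>2 = card T + card (T \<times> T - Id)"
proof -
  have diag: "Id_on T = (\<lambda>t. (t, t)) ` T" by auto
  have "(card T)\<^sup>2 = card (T \<times> T)"
    by (simp add: card_cartesian_product power2_eq_square)
  also have "T \<times> T = Id_on T \<union> (T \<times> T - Id)"
    by auto
  also have "card \<dots> = card (Id_on T) + card (T \<times> T - Id)"
    using assms by (intro card_Un_disjoint) (auto simp: diag)
  also have "card (Id_on T) = card T"
    unfolding diag by (intro card_image inj_onI) simp
  finally show ?thesis .
qed

theorem distinct_differences_card_le:
  assumes "finite D" "finite S" "distinct_differences D"
  shows "card S * (card D)\<^sup>2 \<le> card (difference_set D S) * (card S + card D)"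
proof (cases "card S = 0")
  case False
  define X where "X = difference_set D S"
  define n where "n x = card (in_translate D S x)" for x
  have sum_n: "(\<Sum>x\<in>X. n x) = card D * card S"
    using sum_card_in_translate[OF assms(1,2)] by (simp add: X_def n_def)
  have pairs: "(\<Sum>x\<in>X. card (in_translate D S x \<times> in_translate D S x - Id)) \<le> (card S)\<^sup>2"
    using assms
    by (intro sum_card_in_translate_pairs_le) (simp_all add: X_def finite_difference_set)
  have "(\<Sum>x\<in>X. (n x)\<^sup>2) =
      (\<Sum>x\<in>X. n x) + (\<Sum>x\<in>X. card (in_translate D S x \<times> in_translate D S x - Id))"
    using assms(1) unfolding n_def
    by (simp add: square_card_eq_card_add_off_diagonal finite_in_translate sum.distrib)
  also have "\<dots> \<le> card D * card S + (card S)\<^sup>2"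
    using pairs by (simp add: sum_n)
  finally have sum_n2: "(\<Sum>x\<in>X. (n x)\<^sup>2) \<le> card D * card S + (card S)\<^sup>2" .
  have "real ((\<Sum>x\<in>X. n x)\<^sup>2) \<le> real ((\<Sum>x\<in>X. (n x)\<^sup>2) * card X)"
    using sum_squared_le_sum_of_squares[of "\<lambda>x. real (n x)" X] by simp
  then have "(card D * card S)\<^sup>2 \<le> (\<Sum>x\<in>X. (n x)\<^sup>2) * card X"
    unfolding of_nat_le_iff sum_n .
  also have "\<dots> \<le> (card D * card S + (card S)\<^sup>2) * card X"
    using sum_n2 by (rule mult_right_mono) simp
  finally have "card S * (card S * (card D)\<^sup>2) \<le> card S * (card X * (card S + card D))"
    by (simp add: power2_eq_square algebra_simps)
  with False show ?thesis by (simp add: X_def)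
qed simp

section \<open>Steiner symmetrization\<close>

definition chord :: "'a::real_inner \<Rightarrow> 'a set \<Rightarrow> 'a \<Rightarrow> real set" where
  "chord e A x = {t. x + (t - x \<bullet> e) *\<^sub>R e \<in> A}"

text \<open>The inequality is strict so that no point is placed on a line missing \<open>A\<close>, which keeps the
  diameter under control.\<close>

definition steiner :: "'a::euclidean_space \<Rightarrow> 'a set \<Rightarrow> 'a set" where
  "steiner e A = {x. 2 * \<bar>x \<bullet> e\<bar> < measure lborel (chord e A x)}"

lemma chord_add_scaleR:
  assumes "norm e = 1"
  shows "chord e A (x + t *\<^sub>R e) = chord e A x"
  using assms by (simp add: chord_def inner_add_left norm_eq_1 algebra_simps)

lemma chord_borel:
  fixes A :: "'a::euclidean_space set"
  assumes [measurable]: "A \<in> sets borel"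
  shows "chord e A x \<in> sets borel"
  unfolding chord_def by measurable

lemma bounded_chord:
  assumes "bounded A" "norm e = 1"
  shows "bounded (chord e A x)"
proof -
  have "t \<in> (\<lambda>y. y \<bullet> e) ` A" if "t \<in> chord e A x" for t
    using that \<open>norm e = 1\<close> unfolding chord_def
    by (intro image_eqI[where x = "x + (t - x \<bullet> e) *\<^sub>R e"]) (auto simp: inner_add_left norm_eq_1)
  then have "chord e A x \<subseteq> (\<lambda>y. y \<bullet> e) ` A" by blast
  moreover have "bounded ((\<lambda>y. y \<bullet> e) ` A)"
    using \<open>bounded A\<close> by (rule bounded_linear_image) (rule bounded_linear_inner_left)
  ultimately show ?thesis by (rule bounded_subset[rotated])
qed

lemma chord_steiner:
  assumes "norm e = 1"
  shows "chord e (steiner e A) x =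
    {- measure lborel (chord e A x) / 2 <..< measure lborel (chord e A x) / 2}"
proof (rule set_eqI)
  fix t
  have "t \<in> chord e (steiner e A) x \<longleftrightarrow> x + (t - x \<bullet> e) *\<^sub>R e \<in> steiner e A"
    by (simp add: chord_def)
  also have "\<dots> \<longleftrightarrow> 2 * \<bar>t\<bar> < measure lborel (chord e A x)"
    using assms
    by (simp add: steiner_def chord_add_scaleR inner_add_left flip: power2_norm_eq_inner)
  finally show "t \<in> chord e (steiner e A) x \<longleftrightarrow>
      t \<in> {- measure lborel (chord e A x) / 2 <..< measure lborel (chord e A x) / 2}"
    by auto
qed

lemma steiner_borel:
  fixes A :: "'a::euclidean_space set"
  assumes "A \<in> sets borel"
  shows "steiner e A \<in> sets borel"
proof -
  define E where "E = (\<lambda>(x, t). x + (t - x \<bullet> e) *\<^sub>R e) -` A"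
  have "(\<lambda>(x, t). x + (t - x \<bullet> e) *\<^sub>R e) \<in> borel_measurable borel"
    unfolding case_prod_unfold by (intro borel_measurable_continuous_onI continuous_intros)
  then have "E \<in> sets (lborel \<Otimes>\<^sub>M lborel)"
    using assms unfolding E_def lborel_prod sets_lborel by (rule measurable_sets_borel)
  then have "(\<lambda>x. emeasure lborel (Pair x -` E)) \<in> borel_measurable (lborel :: 'a measure)"
    by (rule lborel.measurable_emeasure_Pair)
  moreover have "Pair x -` E = chord e A x" for x
    by (auto simp: E_def chord_def)
  ultimately have [measurable]: "(\<lambda>x. measure lborel (chord e A x)) \<in> borel_measurable borel"
    unfolding measure_def by simp
  show ?thesis
    unfolding steiner_def by measurable
qed

lemma emeasure_lborel_eq_nn_integral_chord:
  fixes A :: "'a::euclidean_space set"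
  assumes "e \<in> Basis" and A [measurable]: "A \<in> sets borel"
  shows "emeasure lborel A =
    (\<integral>\<^sup>+ f. emeasure lborel (chord e A (\<Sum>b\<in>Basis - {e}. f b *\<^sub>R b)) \<partial>(\<Pi>\<^sub>M b\<in>Basis - {e}. lborel))"
proof -
  interpret product_sigma_finite "\<lambda>_::'a. lborel :: real measure" by standard
  define \<phi> where "\<phi> f = (\<Sum>b\<in>Basis. f b *\<^sub>R b)" for f :: "'a \<Rightarrow> real"
  have [measurable]: "\<phi> \<in> borel_measurable (\<Pi>\<^sub>M b\<in>insert e (Basis - {e}). lborel)"
    unfolding \<phi>_def using \<open>e \<in> Basis\<close> by (simp add: insert_absorb)
  have indicator_measurable:
    "(\<lambda>f. indicator A (\<phi> f) :: ennreal) \<in> borel_measurable (\<Pi>\<^sub>M b\<in>insert e (Basis - {e}). lborel)"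
    by measurable
  have indicator_upd: "indicator A (\<phi> (f(e := t))) =
    (indicator (chord e A (\<Sum>b\<in>Basis - {e}. f b *\<^sub>R b)) t :: ennreal)" for f t
  proof -
    have "\<phi> (f(e := t)) = t *\<^sub>R e + (\<Sum>b\<in>Basis - {e}. f b *\<^sub>R b)"
      unfolding \<phi>_def by (subst sum.remove[OF _ \<open>e \<in> Basis\<close>]) simp_all
    moreover have "(\<Sum>b\<in>Basis - {e}. f b *\<^sub>R b) \<bullet> e = 0"
      using \<open>e \<in> Basis\<close> by (simp add: inner_sum_left inner_not_same_Basis)
    ultimately show ?thesis by (simp add: chord_def indicator_def add.commute)
  qed
  have "emeasure lborel A = (\<integral>\<^sup>+ f. indicator A (\<phi> f) \<partial>(\<Pi>\<^sub>M b\<in>insert e (Basis - {e}). lborel))"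
    using A \<open>e \<in> Basis\<close>
    by (subst lborel_eq)
       (simp add: nn_integral_distr insert_absorb \<phi>_def flip: nn_integral_indicator)
  also have "\<dots> = (\<integral>\<^sup>+ f. (\<integral>\<^sup>+ t. indicator A (\<phi> (f(e := t))) \<partial>lborel) \<partial>(\<Pi>\<^sub>M b\<in>Basis - {e}. lborel))"
    by (rule product_nn_integral_insert[OF _ _ indicator_measurable]) simp_all
  finally show ?thesis
    using A by (simp add: indicator_upd chord_borel)
qed

lemma emeasure_steiner:
  assumes e: "e \<in> Basis" and A: "A \<in> sets borel" "bounded A"
  shows "emeasure lborel (steiner e A) = emeasure lborel A"
proof -
  have "emeasure lborel (chord e A x) < \<infinity>" for x
    using e A by (intro emeasure_bounded_finite bounded_chord) simp_all
  then have "emeasure lborel (chord e (steiner e A) x) = emeasure lborel (chord e A x)" for x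
    using e by (simp add: chord_steiner emeasure_eq_ennreal_measure less_top)
  then show ?thesis
    using e A by (simp add: emeasure_lborel_eq_nn_integral_chord steiner_borel)
qed

lemma measure_lborel_le_Sup_minus_Inf:
  fixes W :: "real set"
  assumes "W \<noteq> {}" "bounded W" "W \<in> sets borel"
  shows "measure lborel W \<le> Sup W - Inf W"
proof -
  have bdd: "bdd_below W" "bdd_above W"
    using \<open>bounded W\<close> by (auto simp: bounded_imp_bdd_below bounded_imp_bdd_above)
  then have "Inf W \<le> Sup W" using \<open>W \<noteq> {}\<close> by (intro cInf_le_cSup)
  moreover have "W \<subseteq> {Inf W..Sup W}" using bdd by (auto intro: cInf_lower cSup_upper)
  then have "measure lborel W \<le> measure lborel {Inf W..Sup W}"
    using \<open>W \<in> sets borel\<close> by (intro measure_mono_fmeasurable fmeasurable_compact) simp_all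
  ultimately show ?thesis by simp
qed

lemma Sup_minus_Inf_le:
  fixes U V :: "real set"
  assumes "U \<noteq> {}" "V \<noteq> {}" and t: "\<And>u v. u \<in> U \<Longrightarrow> v \<in> V \<Longrightarrow> u - v \<le> t"
  shows "Sup U - Inf V \<le> t"
proof -
  have "Sup U - t \<le> v" if "v \<in> V" for v
  proof -
    have "Sup U \<le> v + t"
      using t[OF _ that] \<open>U \<noteq> {}\<close> by (intro cSup_least) (auto simp: algebra_simps)
    then show ?thesis by simp
  qed
  then have "Sup U - t \<le> Inf V" using \<open>V \<noteq> {}\<close> by (intro cInf_greatest)
  then show ?thesis by simp
qed

lemma measure_lborel_add_le:
  fixes U V :: "real set"
  assumes "U \<noteq> {}" "bounded U" "U \<in> sets borel" "V \<noteq> {}" "bounded V" "V \<in> sets borel"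
    and t: "\<And>u v. u \<in> U \<Longrightarrow> v \<in> V \<Longrightarrow> \<bar>u - v\<bar> \<le> t"
  shows "measure lborel U + measure lborel V \<le> 2 * t"
proof -
  have "Sup U - Inf V \<le> t" "Sup V - Inf U \<le> t"
    using assms by (force intro!: Sup_minus_Inf_le simp: abs_le_iff)+
  then show ?thesis
    using assms measure_lborel_le_Sup_minus_Inf[of U] measure_lborel_le_Sup_minus_Inf[of V] by simp
qed

lemma norm_replace_component:
  fixes x e :: "'a::real_inner"
  assumes "norm e = 1"
  shows "(norm (x + (t - x \<bullet> e) *\<^sub>R e))\<^sup>2 = (norm x)\<^sup>2 - (x \<bullet> e)\<^sup>2 + t\<^sup>2"
  using assms unfolding power2_norm_eq_inner inner_add_left inner_add_right
  by (simp add: norm_eq_1 inner_commute power2_eq_square algebra_simps)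

lemma chord_dist_le_diameter:
  assumes "norm e = 1" "bounded A" and u: "u \<in> chord e A p" and v: "v \<in> chord e A q"
  shows "(norm (p - q))\<^sup>2 - ((p - q) \<bullet> e)\<^sup>2 + (u - v)\<^sup>2 \<le> (diameter A)\<^sup>2"
proof -
  define p' q' where "p' = p + (u - p \<bullet> e) *\<^sub>R e" and "q' = q + (v - q \<bullet> e) *\<^sub>R e"
  have "p' - q' = (p - q) + ((u - v) - (p - q) \<bullet> e) *\<^sub>R e"
    by (simp add: p'_def q'_def inner_diff_left algebra_simps)
  then have "(norm (p - q))\<^sup>2 - ((p - q) \<bullet> e)\<^sup>2 + (u - v)\<^sup>2 = (dist p' q')\<^sup>2"
    using \<open>norm e = 1\<close> by (simp add: dist_norm norm_replace_component)
  also have "\<dots> \<le> (diameter A)\<^sup>2"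
    using u v \<open>bounded A\<close>
    by (intro power_mono diameter_bounded_bound) (auto simp: chord_def p'_def q'_def)
  finally show ?thesis .
qed

lemma dist_steiner_le:
  fixes A :: "'a::euclidean_space set"
  assumes e: "norm e = 1" and A: "A \<in> sets borel" "bounded A"
    and p: "p \<in> steiner e A" and q: "q \<in> steiner e A"
  shows "dist p q \<le> diameter A"
proof -
  define U V where "U = chord e A p" and "V = chord e A q"
  define h where "h = (norm (p - q))\<^sup>2 - ((p - q) \<bullet> e)\<^sup>2"
  have dist_sq: "h + (u - v)\<^sup>2 \<le> (diameter A)\<^sup>2" if "u \<in> U" "v \<in> V" for u v
    using that e A unfolding h_def U_def V_def by (intro chord_dist_le_diameter)
  have half: "2 * \<bar>p \<bullet> e\<bar> < measure lborel U" "2 * \<bar>q \<bullet> e\<bar> < measure lborel V"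
    using p q by (auto simp: steiner_def U_def V_def)
  then have "U \<noteq> {}" "V \<noteq> {}" by auto
  then obtain u v where "u \<in> U" "v \<in> V" by blast
  then have "h \<le> (diameter A)\<^sup>2" using dist_sq[of u v] zero_le_power2[of "u - v"] by linarith
  define t where "t = sqrt ((diameter A)\<^sup>2 - h)"
  have "measure lborel U + measure lborel V \<le> 2 * t"
  proof (rule measure_lborel_add_le)
    show "\<bar>u - v\<bar> \<le> t" if "u \<in> U" "v \<in> V" for u v
      unfolding t_def using dist_sq[OF that] by (intro real_le_rsqrt) simp
  qed (use e A \<open>U \<noteq> {}\<close> \<open>V \<noteq> {}\<close> in \<open>auto simp: U_def V_def bounded_chord chord_borel\<close>)
  with half have "\<bar>(p - q) \<bullet> e\<bar> \<le> t" unfolding inner_diff_left by linarith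
  then have "((p - q) \<bullet> e)\<^sup>2 \<le> t\<^sup>2" by (metis abs_ge_zero power2_abs power_mono)
  then have "(dist p q)\<^sup>2 \<le> (diameter A)\<^sup>2"
    using \<open>h \<le> (diameter A)\<^sup>2\<close> by (simp add: t_def h_def dist_norm)
  then show ?thesis
    using diameter_ge_0[OF \<open>bounded A\<close>] by (rule power2_le_imp_le)
qed

lemma bounded_steiner:
  fixes A :: "'a::euclidean_space set"
  assumes "norm e = 1" "A \<in> sets borel" "bounded A"
  shows "bounded (steiner e A)"
  unfolding bounded_two_points using dist_steiner_le[OF assms] by blast

lemma diameter_steiner_le:
  fixes A :: "'a::euclidean_space set"
  assumes "norm e = 1" "A \<in> sets borel" "bounded A"
  shows "diameter (steiner e A) \<le> diameter A"
  using dist_steiner_le[OF assms] diameter_ge_0[OF \<open>bounded A\<close>]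
  by (intro diameter_le) (auto simp: dist_norm)

section \<open>The isodiametric inequality\<close>

definition reflect :: "'a::real_inner \<Rightarrow> 'a \<Rightarrow> 'a" where
  "reflect e x = x - (2 * (x \<bullet> e)) *\<^sub>R e"

lemma reflect_steiner_self:
  assumes "norm e = 1" "x \<in> steiner e A"
  shows "reflect e x \<in> steiner e A"
proof -
  have "chord e A (reflect e x) = chord e A x"
    using chord_add_scaleR[OF assms(1), of A x "- 2 * (x \<bullet> e)"] by (simp add: reflect_def)
  moreover have "reflect e x \<bullet> e = - (x \<bullet> e)"
    using assms(1) by (simp add: reflect_def inner_diff_left norm_eq_1)
  ultimately show ?thesis using assms(2) by (simp add: steiner_def)
qed

lemma reflect_steiner_orthogonal:
  assumes "norm f = 1" "e \<bullet> f = 0"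
    and sym: "\<And>x. x \<in> A \<Longrightarrow> reflect f x \<in> A" and "x \<in> steiner e A"
  shows "reflect f x \<in> steiner e A"
proof -
  have "reflect f y \<in> A \<longleftrightarrow> y \<in> A" for y
  proof -
    have "reflect f (reflect f y) = y"
      using assms(1) by (simp add: reflect_def inner_diff_left norm_eq_1)
    then show ?thesis using sym by metis
  qed
  moreover have inner: "reflect f x \<bullet> e = x \<bullet> e"
    using assms(2) by (simp add: reflect_def inner_diff_left inner_commute[of f e])
  moreover have "reflect f x + s *\<^sub>R e = reflect f (x + s *\<^sub>R e)" for s
    using assms(2) by (simp add: reflect_def inner_add_left)
  ultimately have "chord e A (reflect f x) = chord e A x"
    by (simp add: chord_def)
  with inner show ?thesis using \<open>x \<in> steiner e A\<close> by (simp add: steiner_def)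
qed

lemma reflection_symmetric_rearrangement_exists:
  fixes A :: "'a::euclidean_space set"
  assumes A: "A \<in> sets borel" "bounded A" and "F \<subseteq> Basis"
  shows "\<exists>B :: 'a set. B \<in> sets borel \<and> bounded B \<and> emeasure lborel B = emeasure lborel A \<and>
    diameter B \<le> diameter A \<and> (\<forall>e\<in>F. \<forall>x\<in>B. reflect e x \<in> B)"
proof -
  have "finite F" using \<open>F \<subseteq> Basis\<close> finite_Basis by (rule finite_subset)
  then show ?thesis using \<open>F \<subseteq> Basis\<close>
  proof (induction F)
    case empty
    show ?case using A by auto
  next
    case (insert e F)
    then obtain B where B: "B \<in> sets borel" "bounded B" "emeasure lborel B = emeasure lborel A"
      "diameter B \<le> diameter A" and sym: "\<And>f x. f \<in> F \<Longrightarrow> x \<in> B \<Longrightarrow> reflect f x \<in> B"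
      by auto
    have e: "e \<in> Basis" "norm e = 1" using insert.prems by auto
    have "reflect f x \<in> steiner e B" if "f \<in> insert e F" "x \<in> steiner e B" for f x
    proof (cases "f = e")
      case True
      then show ?thesis using that e by (simp add: reflect_steiner_self)
    next
      case False
      then have "f \<in> F" "f \<in> Basis" "e \<bullet> f = 0"
        using that insert.prems by (auto simp: inner_not_same_Basis)
      then show ?thesis using that sym by (intro reflect_steiner_orthogonal) auto
    qed
    moreover have "diameter (steiner e B) \<le> diameter A"
      using diameter_steiner_le[OF e(2) B(1,2)] B(4) by simp
    ultimately show ?case
      using B e
      by (intro exI[of _ "steiner e B"])
         (simp add: steiner_borel bounded_steiner emeasure_steiner)
  qed
qed

lemma uminus_mem_if_reflect_mem:
  fixes B :: "'a::euclidean_space set"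
  assumes sym: "\<And>e x. e \<in> Basis \<Longrightarrow> x \<in> B \<Longrightarrow> reflect e x \<in> B" and "x \<in> B"
  shows "- x \<in> B"
proof -
  have "x - 2 *\<^sub>R (\<Sum>e\<in>F. (x \<bullet> e) *\<^sub>R e) \<in> B" if "finite F" "F \<subseteq> Basis" for F
    using that
  proof (induction F)
    case empty
    show ?case using \<open>x \<in> B\<close> by simp
  next
    case (insert e F)
    define y where "y = x - 2 *\<^sub>R (\<Sum>e\<in>F. (x \<bullet> e) *\<^sub>R e)"
    have "f \<bullet> e = 0" if "f \<in> F" for f
      using that insert by (intro inner_not_same_Basis) auto
    then have "y \<bullet> e = x \<bullet> e" by (simp add: y_def inner_diff_left inner_sum_left)
    then have "x - 2 *\<^sub>R (\<Sum>e\<in>insert e F. (x \<bullet> e) *\<^sub>R e) = reflect e y"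
      using insert.hyps by (simp add: reflect_def y_def algebra_simps)
    then show ?case using insert sym by (simp add: y_def)
  qed
  from this[OF finite_Basis order_refl] show ?thesis
    by (simp add: euclidean_representation scaleR_2)
qed

theorem isodiametric:
  fixes A :: "'a::euclidean_space set"
  assumes "A \<in> sets borel" "bounded A"
  shows "emeasure lborel A \<le> ennreal (unit_ball_vol (DIM('a)) * (diameter A / 2) ^ DIM('a))"
proof -
  obtain B :: "'a set" where B: "bounded B" "emeasure lborel B = emeasure lborel A"
    "diameter B \<le> diameter A" "\<And>e x. e \<in> Basis \<Longrightarrow> x \<in> B \<Longrightarrow> reflect e x \<in> B"
    using reflection_symmetric_rearrangement_exists[OF assms order_refl] by blast
  have "B \<subseteq> cball 0 (diameter A / 2)"
  proof
    fix x assume "x \<in> B"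
    then have "- x \<in> B" using B(4) by (rule uminus_mem_if_reflect_mem[rotated])
    with \<open>x \<in> B\<close> have "dist x (- x) \<le> diameter A"
      using B(1,3) diameter_bounded_bound order_trans by blast
    then have "norm (2 *\<^sub>R x) \<le> diameter A" by (simp add: dist_norm scaleR_2)
    then show "x \<in> cball 0 (diameter A / 2)" by simp
  qed
  then have "emeasure lborel B \<le> emeasure lborel (cball (0 :: 'a) (diameter A / 2))"
    by (rule emeasure_mono) simp
  also have "\<dots> = ennreal (unit_ball_vol (DIM('a)) * (diameter A / 2) ^ DIM('a))"
    using diameter_ge_0[OF \<open>bounded A\<close>] by (intro emeasure_cball) simp
  finally show ?thesis by (simp add: B(2))
qed

section \<open>Packing and covering by lattice tiles\<close>

lemma bounded_and_diameter_le_if_near: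
  fixes X Y :: "'a::real_normed_vector set"
  assumes "bounded X" "0 \<le> \<epsilon>" and near: "\<forall>y\<in>Y. \<exists>x\<in>X. dist x y \<le> \<epsilon>"
  shows "bounded Y" and "diameter Y \<le> diameter X + 2 * \<epsilon>"
proof -
  have dist_le: "dist y z \<le> diameter X + 2 * \<epsilon>" if yz: "y \<in> Y" "z \<in> Y" for y z
  proof -
    obtain u v where uv: "u \<in> X" "dist u y \<le> \<epsilon>" "v \<in> X" "dist v z \<le> \<epsilon>"
      using near yz by meson
    have "dist y z \<le> dist u y + dist u v + dist v z"
      by (smt (verit) dist_commute dist_triangle)
    also have "dist u v \<le> diameter X"
      using \<open>bounded X\<close> uv(1,3) by (rule diameter_bounded_bound)
    finally show ?thesis using uv by simp
  qed
  then show "bounded Y"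
    unfolding bounded_two_points by blast
  show "diameter Y \<le> diameter X + 2 * \<epsilon>"
    using dist_le \<open>0 \<le> \<epsilon>\<close> diameter_ge_0[OF \<open>bounded X\<close>]
    by (intro diameter_le) (auto simp: dist_norm)
qed

locale lattice_tiling =
  fixes \<Lambda> F :: "'a::euclidean_space set" and \<rho> :: real
  assumes diff_mem: "p \<in> \<Lambda> \<Longrightarrow> q \<in> \<Lambda> \<Longrightarrow> p - q \<in> \<Lambda>"
    and tiles: "\<exists>!p\<in>\<Lambda>. q - p \<in> F"
    and tile_borel: "F \<in> sets borel"
    and tile_subset_cball: "F \<subseteq> cball 0 \<rho>"
    and tile_measure_pos: "0 < measure lborel F"
begin

abbreviation covolume :: real where
  "covolume \<equiv> measure lborel F"

definition cell :: "'a \<Rightarrow> 'a set" where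
  "cell p = {q. q - p \<in> F}"

lemma radius_nonneg: "0 \<le> \<rho>"
proof -
  have "F \<noteq> {}" using tile_measure_pos by auto
  then show ?thesis using tile_subset_cball by auto
qed

lemma dist_cell_le: "q \<in> cell p \<Longrightarrow> dist p q \<le> \<rho>"
  using tile_subset_cball by (auto simp: cell_def dist_norm norm_minus_commute)

lemma cell_borel: "cell p \<in> sets borel"
  using tile_borel unfolding cell_def by measurable

lemma emeasure_cell: "emeasure lborel (cell p) = ennreal covolume"
proof -
  have "cell p = (+) (- p) -` F"
    by (auto simp: cell_def)
  then have "emeasure lborel (cell p) = emeasure (distr lborel borel ((+) (- p))) F"
    using tile_borel by (simp add: emeasure_distr)
  also have "\<dots> = emeasure lborel F"
    by (simp add: lborel_distr_plus)
  also have "\<dots> = ennreal covolume"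
    using emeasure_bounded_finite[of F] bounded_subset[OF bounded_cball tile_subset_cball]
    by (simp add: emeasure_eq_ennreal_measure less_top)
  finally show ?thesis .
qed

lemma emeasure_UN_cell:
  assumes "finite X" "X \<subseteq> \<Lambda>"
  shows "emeasure lborel (\<Union>p\<in>X. cell p) = ennreal (card X * covolume)"
proof -
  have "disjoint_family_on cell X"
    unfolding disjoint_family_on_def cell_def using assms(2) tiles by blast
  then have "emeasure lborel (\<Union>p\<in>X. cell p) = (\<Sum>p\<in>X. emeasure lborel (cell p))"
    using assms(1) cell_borel by (intro sum_emeasure[symmetric]) auto
  also have "\<dots> = ennreal (card X * covolume)"
    by (simp add: emeasure_cell ennreal_mult ennreal_of_nat_eq_real_of_nat)
  finally show ?thesis .
qed

lemma card_mult_covolume_le: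
  assumes "finite X" "X \<subseteq> \<Lambda>"
  shows "card X * covolume \<le> unit_ball_vol (DIM('a)) * (diameter X / 2 + \<rho>) ^ DIM('a)"
proof -
  have X: "bounded X" using \<open>finite X\<close> by (rule finite_imp_bounded)
  define U where "U = (\<Union>p\<in>X. cell p)"
  have near: "\<forall>q\<in>U. \<exists>p\<in>X. dist p q \<le> \<rho>"
    using dist_cell_le by (auto simp: U_def)
  note U = bounded_and_diameter_le_if_near[OF X radius_nonneg near]
  have "ennreal (card X * covolume) = emeasure lborel U"
    unfolding U_def using assms by (simp add: emeasure_UN_cell)
  also have "\<dots> \<le> ennreal (unit_ball_vol (DIM('a)) * (diameter U / 2) ^ DIM('a))"
    using U(1) \<open>finite X\<close> cell_borel by (intro isodiametric) (auto simp: U_def)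
  also have "\<dots> \<le> ennreal (unit_ball_vol (DIM('a)) * (diameter X / 2 + \<rho>) ^ DIM('a))"
    using U diameter_ge_0 by (intro ennreal_leI mult_left_mono power_mono) auto
  finally show ?thesis
    using radius_nonneg diameter_ge_0[OF X] by (subst (asm) ennreal_le_iff) auto
qed

lemma finite_Int_cball: "finite (\<Lambda> \<inter> cball 0 s)"
proof -
  define M where "M = unit_ball_vol (DIM('a)) * (diameter (cball (0 :: 'a) s) / 2 + \<rho>) ^ DIM('a)"
  have "card X \<le> nat \<lfloor>M / covolume\<rfloor>" if "X \<subseteq> \<Lambda> \<inter> cball 0 s" "finite X" for X
  proof -
    have "card X * covolume \<le> unit_ball_vol (DIM('a)) * (diameter X / 2 + \<rho>) ^ DIM('a)"
      using that by (intro card_mult_covolume_le) auto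
    also have "\<dots> \<le> M"
      unfolding M_def using that radius_nonneg
      by (intro mult_left_mono power_mono add_right_mono divide_right_mono diameter_subset)
        (auto simp: diameter_ge_0 finite_imp_bounded)
    finally show ?thesis
      using tile_measure_pos by (simp add: le_nat_floor pos_le_divide_eq)
  qed
  then show ?thesis
    using finite_if_finite_subsets_card_bdd by blast
qed

lemma le_card_Int_cball_mult_covolume:
  assumes "\<rho> \<le> s"
  shows "unit_ball_vol (DIM('a)) * (s - \<rho>) ^ DIM('a) \<le> card (\<Lambda> \<inter> cball 0 s) * covolume"
proof -
  have "cball 0 (s - \<rho>) \<subseteq> (\<Union>p\<in>\<Lambda> \<inter> cball 0 s. cell p)"
  proof
    fix q :: 'a
    assume q: "q \<in> cball 0 (s - \<rho>)"
    obtain p where p: "p \<in> \<Lambda>" "q \<in> cell p"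
      using tiles[of q] by (auto simp: cell_def)
    have "dist 0 p \<le> dist 0 q + dist p q" by (rule dist_triangle2)
    also have "\<dots> \<le> s" using q dist_cell_le[OF p(2)] by simp
    finally show "q \<in> (\<Union>p\<in>\<Lambda> \<inter> cball 0 s. cell p)" using p by auto
  qed
  then have "emeasure lborel (cball (0 :: 'a) (s - \<rho>))
      \<le> emeasure lborel (\<Union>p\<in>\<Lambda> \<inter> cball 0 s. cell p)"
    using finite_Int_cball cell_borel by (intro emeasure_mono) auto
  also have "\<dots> = ennreal (card (\<Lambda> \<inter> cball 0 s) * covolume)"
    using finite_Int_cball by (intro emeasure_UN_cell) auto
  finally show ?thesis
    using assms by (subst (asm) emeasure_cball) (simp_all add: ennreal_le_iff)
qed

lemma card_difference_set_mult_covolume_le: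
  assumes D: "finite D" "D \<subseteq> \<Lambda>" "diameter D \<le> r" and "0 \<le> s"
  shows "card (difference_set D (\<Lambda> \<inter> cball 0 s)) * covolume
    \<le> unit_ball_vol (DIM('a)) * (r / 2 + s + \<rho>) ^ DIM('a)"
proof -
  define X where "X = difference_set D (\<Lambda> \<inter> cball 0 s)"
  have "finite X"
    unfolding X_def using D(1) finite_Int_cball by (rule finite_difference_set)
  have "X \<subseteq> \<Lambda>"
    using D(2) diff_mem by (auto simp: X_def difference_set_def)
  have "diameter X \<le> diameter D + 2 * s"
  proof (rule bounded_and_diameter_le_if_near(2))
    have "dist d (d - t) \<le> s" if "t \<in> cball 0 s" for d t :: 'a
      using that by (simp add: dist_norm)
    then show "\<forall>x\<in>X. \<exists>d\<in>D. dist d x \<le> s"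
      unfolding X_def difference_set_def by blast
  qed (use D(1) finite_imp_bounded \<open>0 \<le> s\<close> in auto)
  then have "diameter X / 2 + \<rho> \<le> r / 2 + s + \<rho>"
    using D(3) by simp
  then have "unit_ball_vol (DIM('a)) * (diameter X / 2 + \<rho>) ^ DIM('a)
      \<le> unit_ball_vol (DIM('a)) * (r / 2 + s + \<rho>) ^ DIM('a)"
    using radius_nonneg diameter_ge_0[OF finite_imp_bounded[OF \<open>finite X\<close>]]
    by (intro mult_left_mono power_mono) auto
  with card_mult_covolume_le[OF \<open>finite X\<close> \<open>X \<subseteq> \<Lambda>\<close>] show ?thesis
    unfolding X_def by (rule order_trans)
qed

theorem distinct_differences_square_card_le:
  assumes D: "finite D" "D \<subseteq> \<Lambda>" "distinct_differences D" "diameter D \<le> r" and "\<rho> < s"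
  defines "w \<equiv> r / 2 + s + \<rho>"
  shows "(real (card D))\<^sup>2 \<le> unit_ball_vol (DIM('a)) / covolume * w ^ DIM('a)
    + (w / (s - \<rho>)) ^ DIM('a) * card D"
proof -
  define S where "S = \<Lambda> \<inter> cball 0 s"
  define a N where "a = real (card S)" and "N = real (card (difference_set D S))"
  define \<omega> where "\<omega> = unit_ball_vol (DIM('a))"
  have "0 < \<omega>" by (simp add: \<omega>_def)
  have "N * covolume \<le> \<omega> * w ^ DIM('a)"
    unfolding N_def S_def \<omega>_def w_def using D \<open>\<rho> < s\<close> radius_nonneg
    by (intro card_difference_set_mult_covolume_le) auto
  then have N_upper: "N \<le> \<omega> / covolume * w ^ DIM('a)"
    using tile_measure_pos by (simp add: field_simps)
  have "\<omega> * (s - \<rho>) ^ DIM('a) \<le> a * covolume"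
    unfolding \<omega>_def a_def S_def using \<open>\<rho> < s\<close> by (intro le_card_Int_cball_mult_covolume) simp
  then have a_lower: "\<omega> / covolume * (s - \<rho>) ^ DIM('a) \<le> a"
    using tile_measure_pos by (simp add: field_simps)
  have pos: "0 < \<omega> / covolume * (s - \<rho>) ^ DIM('a)"
    using \<open>0 < \<omega>\<close> \<open>\<rho> < s\<close> tile_measure_pos by simp
  have "N / a \<le> (\<omega> / covolume * w ^ DIM('a)) / (\<omega> / covolume * (s - \<rho>) ^ DIM('a))"
    using N_upper a_lower pos by (intro frac_le) (auto simp: N_def)
  also have "\<dots> = (w / (s - \<rho>)) ^ DIM('a)"
    using \<open>0 < \<omega>\<close> tile_measure_pos by (simp add: power_divide)
  finally have ratio: "N / a \<le> (w / (s - \<rho>)) ^ DIM('a)" .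
  have "real (card S * (card D)\<^sup>2) \<le> real (card (difference_set D S) * (card S + card D))"
    unfolding of_nat_le_iff S_def using D(1,3) finite_Int_cball
    by (intro distinct_differences_card_le)
  then have "(real (card D))\<^sup>2 \<le> N + N / a * card D"
    using pos a_lower by (simp add: N_def a_def field_simps)
  also have "\<dots> \<le> \<omega> / covolume * w ^ DIM('a) + (w / (s - \<rho>)) ^ DIM('a) * card D"
    using N_upper ratio by (intro add_mono mult_right_mono) auto
  finally show ?thesis by (simp add: \<omega>_def)
qed

end

section \<open>The optimal radius\<close>

lemma quadratic_inequality_upper_bound:
  fixes m b q :: real
  assumes "m\<^sup>2 \<le> q\<^sup>2 + b * m" "0 < q" "0 \<le> b"
  shows "m \<le> q + b / 2 + b\<^sup>2 / (8 * q)"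
proof (rule ccontr)
  define e where "e = b\<^sup>2 / (8 * q)"
  assume "\<not> ?thesis"
  then have "q + e < m - b / 2" by (simp add: e_def)
  moreover have "0 \<le> e" using assms by (simp add: e_def)
  ultimately have "(q + e)\<^sup>2 < (m - b / 2)\<^sup>2" using assms by (intro power_strict_mono) auto
  also have "\<dots> \<le> q\<^sup>2 + b\<^sup>2 / 4" using assms(1) by (simp add: power2_eq_square field_simps)
  finally have "2 * q * e + e\<^sup>2 < b\<^sup>2 / 4" by (simp add: power2_eq_square algebra_simps)
  moreover have "2 * q * e = b\<^sup>2 / 4" using assms(2) by (simp add: e_def)
  ultimately show False using zero_le_power2[of e] by linarith
qed

text \<open>With \<open>r = u\<^sup>3\<close> and \<open>s = c u\<^sup>2 + \<rho>\<close> this is \<open>r / 2 + s + \<rho>\<close>.\<close>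

definition outer_radius :: "real \<Rightarrow> real \<Rightarrow> real \<Rightarrow> real" where
  "outer_radius c \<rho> u = u ^ 3 / 2 + c * u\<^sup>2 + 2 * \<rho>"

lemma outer_radius_pos: "0 < c \<Longrightarrow> 0 \<le> \<rho> \<Longrightarrow> 1 \<le> u \<Longrightarrow> 0 < outer_radius c \<rho> u"
  by (simp add: outer_radius_def add_pos_nonneg)

lemma outer_radius_le_cube:
  assumes "0 < c" "0 \<le> \<rho>" "1 \<le> u"
  shows "outer_radius c \<rho> u \<le> (1/2 + c + 2 * \<rho>) * u ^ 3"
proof -
  have "c * u\<^sup>2 \<le> c * u ^ 3" "2 * \<rho> \<le> 2 * \<rho> * u ^ 3"
    using assms mult_left_mono[of 1 "u ^ 3" \<rho>] by (simp_all add: power_increasing)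
  then show ?thesis unfolding outer_radius_def distrib_right by linarith
qed

lemma outer_radius_ratio_square_le:
  assumes "0 < c" "0 \<le> \<rho>" "1 \<le> u"
  defines "K \<equiv> 1 + 2 * \<rho> / c"
  shows "(outer_radius c \<rho> u / (c * u\<^sup>2))\<^sup>2 \<le> u\<^sup>2 / (4 * c\<^sup>2) + (K / c + K\<^sup>2) * u"
proof -
  have "outer_radius c \<rho> u / (c * u\<^sup>2) = u / (2 * c) + 1 + 2 * \<rho> / (c * u\<^sup>2)"
    using assms by (simp add: outer_radius_def field_simps power2_eq_square power3_eq_cube)
  also have "2 * \<rho> / (c * u\<^sup>2) \<le> 2 * \<rho> / c"
    using assms by (intro divide_left_mono) auto
  finally have "outer_radius c \<rho> u / (c * u\<^sup>2) \<le> u / (2 * c) + K" by (simp add: K_def)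
  then have "(outer_radius c \<rho> u / (c * u\<^sup>2))\<^sup>2 \<le> (u / (2 * c) + K)\<^sup>2"
    using assms(1-3) outer_radius_pos[of c \<rho> u] by (intro power_mono) auto
  also have "\<dots> = u\<^sup>2 / (4 * c\<^sup>2) + K / c * u + K\<^sup>2"
    using \<open>0 < c\<close> by (simp add: power2_eq_square field_simps)
  also have "K\<^sup>2 \<le> K\<^sup>2 * u"
    using mult_left_mono[OF \<open>1 \<le> u\<close>, of "K\<^sup>2"] by simp
  finally show ?thesis by (simp add: distrib_right)
qed

lemma outer_radius_ratio_fourth_power_le:
  fixes \<kappa> :: real
  assumes pos: "0 < \<kappa>" "0 < c" "0 \<le> \<rho>" "1 \<le> u"
  defines "w \<equiv> outer_radius c \<rho> u"
  shows "((w / (c * u\<^sup>2))\<^sup>2)\<^sup>2 / (8 * (\<kappa> * w)) \<le> (1/2 + c + 2 * \<rho>) ^ 3 / (8 * \<kappa> * c ^ 4) * u"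
proof -
  have "0 < w" using pos by (simp add: w_def outer_radius_pos)
  then have "w ^ 3 \<le> ((1/2 + c + 2 * \<rho>) * u ^ 3) ^ 3"
    using pos outer_radius_le_cube[of c \<rho> u] by (intro power_mono) (simp_all add: w_def)
  then have "w ^ 3 / (8 * \<kappa> * c ^ 4 * u ^ 8)
      \<le> ((1/2 + c + 2 * \<rho>) * u ^ 3) ^ 3 / (8 * \<kappa> * c ^ 4 * u ^ 8)"
    using pos by (intro divide_right_mono) auto
  also have "\<dots> = (1/2 + c + 2 * \<rho>) ^ 3 / (8 * \<kappa> * c ^ 4) * u"
    unfolding power_mult_distrib using pos by (simp add: eval_nat_numeral)
  also have "w ^ 3 / (8 * \<kappa> * c ^ 4 * u ^ 8) = ((w / (c * u\<^sup>2))\<^sup>2)\<^sup>2 / (8 * (\<kappa> * w))"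
    using \<open>0 < w\<close> by (simp add: power_divide power_mult_distrib eval_nat_numeral)
  finally show ?thesis .
qed

lemma radius_tradeoff:
  fixes \<kappa> c \<rho> :: real
  assumes pos: "0 < \<kappa>" "0 < c" "0 \<le> \<rho>"
  shows "\<exists>C. \<forall>u\<ge>1. \<forall>m.
    m\<^sup>2 \<le> (\<kappa> * outer_radius c \<rho> u)\<^sup>2 + (outer_radius c \<rho> u / (c * u\<^sup>2))\<^sup>2 * m \<longrightarrow>
    m \<le> \<kappa> / 2 * u ^ 3 + (\<kappa> * c + 1 / (8 * c\<^sup>2)) * u\<^sup>2 + C * u"
proof -
  define K where "K = 1 + 2 * \<rho> / c"
  define E where "E = (1/2 + c + 2 * \<rho>) ^ 3 / (8 * \<kappa> * c ^ 4)"
  have "m \<le> \<kappa> / 2 * u ^ 3 + (\<kappa> * c + 1 / (8 * c\<^sup>2)) * u\<^sup>2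
      + (2 * \<rho> * \<kappa> + (K / c + K\<^sup>2) / 2 + E) * u"
    if "1 \<le> u" and w: "w = outer_radius c \<rho> u" and m: "m\<^sup>2 \<le> (\<kappa> * w)\<^sup>2 + (w / (c * u\<^sup>2))\<^sup>2 * m"
    for u m w
  proof -
    have "0 < \<kappa> * w" using pos \<open>1 \<le> u\<close> by (simp add: w outer_radius_pos)
    with m have "m \<le> \<kappa> * w + (w / (c * u\<^sup>2))\<^sup>2 / 2 + ((w / (c * u\<^sup>2))\<^sup>2)\<^sup>2 / (8 * (\<kappa> * w))"
      by (rule quadratic_inequality_upper_bound) simp
    moreover have "\<kappa> * w = \<kappa> / 2 * u ^ 3 + \<kappa> * c * u\<^sup>2 + 2 * \<rho> * \<kappa>"
      by (simp add: w outer_radius_def algebra_simps)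
    moreover have "2 * \<rho> * \<kappa> \<le> 2 * \<rho> * \<kappa> * u"
      using mult_left_mono[OF \<open>1 \<le> u\<close>, of "2 * \<rho> * \<kappa>"] pos by simp
    moreover have "(w / (c * u\<^sup>2))\<^sup>2 / 2 \<le> 1 / (8 * c\<^sup>2) * u\<^sup>2 + (K / c + K\<^sup>2) / 2 * u"
      using outer_radius_ratio_square_le[OF pos(2,3) \<open>1 \<le> u\<close>] by (simp add: w K_def)
    moreover have "((w / (c * u\<^sup>2))\<^sup>2)\<^sup>2 / (8 * (\<kappa> * w)) \<le> E * u"
      unfolding w E_def using pos \<open>1 \<le> u\<close> by (rule outer_radius_ratio_fourth_power_le)
    ultimately show ?thesis unfolding distrib_right by linarith
  qed
  then show ?thesis by blast
qed

lemma optimal_radius_coefficient: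
  fixes \<kappa> :: real
  assumes "0 < \<kappa>"
  defines "c \<equiv> (1 / (4 * \<kappa>)) powr (1/3)"
  shows "\<kappa> * c + 1 / (8 * c\<^sup>2) = 3/2 * (\<kappa>\<^sup>2 / 4) powr (1/3)"
proof -
  have "0 < c" using assms by (simp add: c_def)
  have "c ^ 3 = 1 / (4 * \<kappa>)"
    using assms by (simp add: c_def powr_powr flip: powr_numeral)
  have "1 / (8 * c\<^sup>2) = c / (8 * c ^ 3)"
    using \<open>0 < c\<close> by (simp add: power2_eq_square power3_eq_cube)
  also have "\<dots> = \<kappa> * c / 2"
    using \<open>0 < \<kappa>\<close> by (simp add: \<open>c ^ 3 = 1 / (4 * \<kappa>)\<close>)
  finally have "\<kappa> * c + 1 / (8 * c\<^sup>2) = 3/2 * (\<kappa> * c)" by simp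
  moreover have "\<kappa> = (\<kappa> ^ 3) powr (1/3)"
    using \<open>0 < \<kappa>\<close> by (simp add: powr_powr flip: powr_numeral)
  then have "\<kappa> * c = (\<kappa> ^ 3 * (1 / (4 * \<kappa>))) powr (1/3)"
    using \<open>0 < \<kappa>\<close> unfolding c_def by (subst powr_mult) simp_all
  then have "\<kappa> * c = (\<kappa>\<^sup>2 / 4) powr (1/3)"
    using \<open>0 < \<kappa>\<close> by (simp add: power2_eq_square power3_eq_cube)
  ultimately show ?thesis by simp
qed

theorem (in lattice_tiling) planar_distinct_differences_card_le:
  assumes "DIM('a) = 2"
  shows "\<exists>C. \<forall>r\<ge>1. \<forall>D\<subseteq>\<Lambda>. finite D \<longrightarrow> distinct_differences D \<longrightarrow> diameter D \<le> r \<longrightarrow>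
    card D \<le> sqrt (pi / covolume) / 2 * r + 3/2 * (pi / (4 * covolume)) powr (1/3) * r powr (2/3)
      + C * r powr (1/3)"
proof -
  define \<kappa> where "\<kappa> = sqrt (pi / covolume)"
  define c where "c = (1 / (4 * \<kappa>)) powr (1/3)"
  have pos: "0 < \<kappa>" "0 < c" using tile_measure_pos by (simp_all add: \<kappa>_def c_def)
  have \<kappa>2: "\<kappa>\<^sup>2 = pi / covolume" using tile_measure_pos by (simp add: \<kappa>_def)
  have coeff: "\<kappa> * c + 1 / (8 * c\<^sup>2) = 3/2 * (pi / (4 * covolume)) powr (1/3)"
    unfolding c_def optimal_radius_coefficient[OF pos(1)] by (simp add: \<kappa>2 mult.commute)
  obtain C where C: "\<And>u m. 1 \<le> u \<Longrightarrow>
      m\<^sup>2 \<le> (\<kappa> * outer_radius c \<rho> u)\<^sup>2 + (outer_radius c \<rho> u / (c * u\<^sup>2))\<^sup>2 * m \<Longrightarrow>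
      m \<le> \<kappa> / 2 * u ^ 3 + (\<kappa> * c + 1 / (8 * c\<^sup>2)) * u\<^sup>2 + C * u"
    using radius_tradeoff[OF pos radius_nonneg] by blast
  have "card D \<le> \<kappa> / 2 * r + (\<kappa> * c + 1 / (8 * c\<^sup>2)) * r powr (2/3) + C * r powr (1/3)"
    if "1 \<le> r" and D: "finite D" "D \<subseteq> \<Lambda>" "distinct_differences D" "diameter D \<le> r" for r D
  proof -
    define u where "u = r powr (1/3)"
    have u: "1 \<le> u" "r = u ^ 3" "r powr (2/3) = u\<^sup>2"
      using \<open>1 \<le> r\<close> by (simp_all add: u_def ge_one_powr_ge_zero powr_powr flip: powr_numeral)
    define s where "s = c * u\<^sup>2 + \<rho>"
    have "\<rho> < s" "s - \<rho> = c * u\<^sup>2" using pos u(1) by (simp_all add: s_def)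
    moreover have "r / 2 + s + \<rho> = outer_radius c \<rho> u" by (simp add: s_def outer_radius_def u(2))
    ultimately have "(real (card D))\<^sup>2
        \<le> (\<kappa> * outer_radius c \<rho> u)\<^sup>2 + (outer_radius c \<rho> u / (c * u\<^sup>2))\<^sup>2 * card D"
      using distinct_differences_square_card_le[OF D \<open>\<rho> < s\<close>]
      by (simp add: assms unit_ball_vol_2 power_mult_distrib \<kappa>2)
    with C[OF u(1)] have "card D \<le> \<kappa> / 2 * u ^ 3 + (\<kappa> * c + 1 / (8 * c\<^sup>2)) * u\<^sup>2 + C * u"
      by blast
    then show ?thesis
      by (simp only: u(3) flip: u(2) u_def)
  qed
  then show ?thesis unfolding coeff by (auto simp: \<kappa>_def)
qed

section \<open>The hexagonal grid\<close>

definition hex_point :: "int \<Rightarrow> int \<Rightarrow> real^2" where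
  "hex_point i j = of_int i *\<^sub>R vector [1, 0] + of_int j *\<^sub>R vector [- 1/2, sqrt 3 / 2]"

lemma hex_grid_eq: "hex_grid = {hex_point i j | i j. True}"
  by (simp add: hex_grid_def hex_point_def)

lemma hex_grid_diff: "p \<in> hex_grid \<Longrightarrow> q \<in> hex_grid \<Longrightarrow> p - q \<in> hex_grid"
proof -
  have "hex_point i j - hex_point i' j' = hex_point (i - i') (j - j')" for i j i' j'
    by (simp add: hex_point_def algebra_simps)
  then show "p \<in> hex_grid \<Longrightarrow> q \<in> hex_grid \<Longrightarrow> p - q \<in> hex_grid"
    unfolding hex_grid_eq by blast
qed

text \<open>The grid consists of horizontal rows at distance \<open>\<surd>3 / 2\<close>, each of spacing \<open>1\<close>.\<close>

definition brick :: "(real^2) set" where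
  "brick = {x. x $ 1 \<in> {- 1/2 ..< 1/2} \<and> x $ 2 \<in> {- sqrt 3 / 4 ..< sqrt 3 / 4}}"

lemma diff_hex_point_mem_brick_iff:
  "q - hex_point i j \<in> brick \<longleftrightarrow>
    j = \<lfloor>2 * q $ 2 / sqrt 3 + 1/2\<rfloor> \<and> i = \<lfloor>q $ 1 + of_int j / 2 + 1/2\<rfloor>"
  unfolding brick_def hex_point_def eq_commute[of _ "floor _"] floor_eq_iff
  by (auto simp: field_simps)

lemma brick_tiles: "\<exists>!p\<in>hex_grid. q - p \<in> brick"
proof -
  define j where "j = \<lfloor>2 * q $ 2 / sqrt 3 + 1/2\<rfloor>"
  define i where "i = \<lfloor>q $ 1 + of_int j / 2 + 1/2\<rfloor>"
  have "q - hex_point i' j' \<in> brick \<longleftrightarrow> i' = i \<and> j' = j" for i' j'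
    by (auto simp: diff_hex_point_mem_brick_iff i_def j_def)
  then show ?thesis
    unfolding hex_grid_eq by (intro ex1I[of _ "hex_point i j"]) auto
qed

lemma brick_borel: "brick \<in> sets borel"
  unfolding brick_def by measurable

lemma measure_brick: "measure lborel brick = sqrt 3 / 2"
proof -
  define h :: "real^2" where "h = vector [1/2, sqrt 3 / 4]"
  have "box (- h) h \<subseteq> brick" "brick \<subseteq> cbox (- h) h"
    by (auto simp: brick_def h_def mem_box_cart forall_2)
  moreover have "brick \<in> fmeasurable lborel"
    using brick_borel \<open>brick \<subseteq> cbox (- h) h\<close> by (intro fmeasurableI2[OF fmeasurable_cbox(1)]) auto
  ultimately have "measure lborel (box (- h) h) \<le> measure lborel brick"
    "measure lborel brick \<le> measure lborel (cbox (- h) h)"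
    by (auto intro!: measure_mono_fmeasurable)
  moreover have "measure lborel (cbox (- h) h) = sqrt 3 / 2"
    by (subst content_cbox_cart) (auto simp: h_def interval_ne_empty_cart forall_2 UNIV_2)
  moreover have "measure lborel (box (- h) h) = measure lborel (cbox (- h) h)"
    by (simp add: measure_lborel_box_eq measure_lborel_cbox_eq)
  ultimately show ?thesis by simp
qed

lemma brick_subset_cball: "brick \<subseteq> cball 0 1"
proof
  fix x :: "real^2"
  assume "x \<in> brick"
  then have "\<bar>x $ 1\<bar> \<le> 1/2" "\<bar>x $ 2\<bar> \<le> sqrt 3 / 4"
    by (auto simp: brick_def)
  moreover have "sqrt 3 \<le> 2" by (rule real_le_lsqrt) simp_all
  ultimately have "\<bar>x $ 1\<bar> + \<bar>x $ 2\<bar> \<le> 1" by linarith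
  then show "x \<in> cball 0 1"
    using norm_le_l1_cart[of x] by (simp add: sum_2)
qed

interpretation hex: lattice_tiling hex_grid brick 1
  by standard
    (simp_all add: hex_grid_diff brick_tiles brick_borel brick_subset_cball measure_brick)

lemma DD_starD:
  assumes "DD_star m r D"
  shows "D \<subseteq> hex_grid" "finite D" "card D = m" "distinct_differences D"
proof -
  have "{(a, b). a \<in> D \<and> b \<in> D \<and> a \<noteq> b} = D \<times> D - Id" by auto
  then show "D \<subseteq> hex_grid" "finite D" "card D = m" "distinct_differences D"
    using assms by (simp_all add: DD_star_iff_differences distinct_differences_def)
qed

lemma DD_star_diameter_le:
  assumes "DD_star m r D" "0 \<le> r"
  shows "diameter D \<le> r"
  using assms by (intro diameter_le) (auto simp: DD_star_def dist_norm)

lemma hex_grid_coefficients: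
  shows "sqrt (pi / (sqrt 3 / 2)) / 2 = sqrt pi / (sqrt 2 * 3 powr (1/4))"
    and "3/2 * (pi / (4 * (sqrt 3 / 2))) powr (1/3) = 3 powr (5/6) * pi powr (1/3) / 2 powr (4/3)"
proof -
  have "sqrt (sqrt 3) = 3 powr (1/4)"
    by (simp add: powr_powr flip: powr_half_sqrt)
  moreover have "sqrt 2 / 2 = 1 / sqrt 2"
    by (simp add: field_simps)
  ultimately show "sqrt (pi / (sqrt 3 / 2)) / 2 = sqrt pi / (sqrt 2 * 3 powr (1/4))"
    by (simp add: real_sqrt_divide real_sqrt_mult field_simps)
  have "(2 * sqrt 3) powr (1/3) = 2 powr (1/3) * 3 powr (1/6)"
    by (simp add: powr_mult powr_powr flip: powr_half_sqrt)
  moreover have "2 * 2 powr (1/3) = (2::real) powr (4/3)"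
    using powr_add[of "2::real" 1 "1/3"] by simp
  moreover have "(3::real) = 3 powr (5/6) * 3 powr (1/6)"
    by (simp flip: powr_add)
  ultimately show "3/2 * (pi / (4 * (sqrt 3 / 2))) powr (1/3) =
      3 powr (5/6) * pi powr (1/3) / 2 powr (4/3)"
    by (simp add: powr_divide field_simps)
qed

theorem theorem9:
  shows "\<exists>C::real. \<forall>r::nat. \<forall>m::nat. r \<ge> 1 \<longrightarrow> (\<exists>D. DD_star m (real r) D) \<longrightarrow>
    real m \<le> sqrt pi / (sqrt 2 * 3 powr (1/4)) * real r
      + 3 powr (5/6) * pi powr (1/3) / 2 powr (4/3) * real r powr (2/3)
      + C * real r powr (1/3)"
proof -
  obtain C where "\<And>r D. 1 \<le> r \<Longrightarrow> D \<subseteq> hex_grid \<Longrightarrow> finite D \<Longrightarrow> distinct_differences D \<Longrightarrow>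
      diameter D \<le> r \<Longrightarrow> card D \<le> sqrt pi / (sqrt 2 * 3 powr (1/4)) * r
        + 3 powr (5/6) * pi powr (1/3) / 2 powr (4/3) * r powr (2/3) + C * r powr (1/3)"
    using hex.planar_distinct_differences_card_le
    unfolding measure_brick hex_grid_coefficients by auto
  then have "real m \<le> sqrt pi / (sqrt 2 * 3 powr (1/4)) * real r
      + 3 powr (5/6) * pi powr (1/3) / 2 powr (4/3) * real r powr (2/3) + C * real r powr (1/3)"
    if "1 \<le> r" "DD_star m (real r) D" for r m D
    using that DD_starD[OF that(2)] DD_star_diameter_le[OF that(2)] by force
  then show ?thesis by blast
qed

end
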